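(* Let $r,s,t$ be positive integers. If $G$ is an $n$-vertex graph with no copy of $K_r$ as a subgraph and no copy of $K_{s,t}$ as an induced subgraph, then \[ e(G) \leq n^{2-1/s}4^s\left((r+t)^{t/s} + (r+s) + 2(r+t)^{t(s+1)/s^2}(r+s)\right) + 2 \cdot 4^s n. \]
   Context: $e(G)$ denotes the number of edges of $G$. $K_r$ is the complete graph on $r$ vertices and $K_{s,t}$ the complete bipartite graph with parts of sizes $s$ and $t$. *)

theory Defs
  imports Complex_Main "HOL-Library.Ramsey"
begin

type_synonym 'a graph = "'a set \<times> 'a set set"

abbreviation verts :: "'a graph \<Rightarrow> 'a set" where
  "verts G \<equiv> fst G"

abbreviation edges :: "'a graph \<Rightarrow> 'a set set" where
  "edges G \<equiv> snd G"

definition simple_graph :: "'a graph \<Rightarrow> bool" where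
  "simple_graph G \<longleftrightarrow> finite (verts G) \<and> edges G \<subseteq> nsets (verts G) 2"

definition complete_graph :: "nat \<Rightarrow> nat graph" where
  "complete_graph r = ({..<r}, nsets {..<r} 2)"

definition complete_bipartite_graph :: "nat \<Rightarrow> nat \<Rightarrow> (nat + nat) graph" where
  "complete_bipartite_graph s t =
    ({..<s} <+> {..<t}, {{Inl i, Inr j} | i j. i < s \<and> j < t})"

definition subgraph :: "'a graph \<Rightarrow> 'a graph \<Rightarrow> bool" where
  "subgraph H G \<longleftrightarrow> simple_graph H \<and> verts H \<subseteq> verts G \<and> edges H \<subseteq> edges G"

definition induced_subgraph :: "'a graph \<Rightarrow> 'a graph \<Rightarrow> bool" where
  "induced_subgraph H G \<longleftrightarrow>
    subgraph H G \<and> edges H = {e \<in> edges G. e \<subseteq> verts H}"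

definition graph_iso :: "'a graph \<Rightarrow> 'b graph \<Rightarrow> bool" where
  "graph_iso G H \<longleftrightarrow>
    (\<exists>f. bij_betw f (verts G) (verts H) \<and> edges H = (\<lambda>e. f ` e) ` edges G)"

definition contains_copy :: "'a graph \<Rightarrow> 'b graph \<Rightarrow> bool" where
  "contains_copy G F \<longleftrightarrow> (\<exists>H. subgraph H G \<and> graph_iso F H)"

definition contains_induced_copy :: "'a graph \<Rightarrow> 'b graph \<Rightarrow> bool" where
  "contains_induced_copy G F \<longleftrightarrow> (\<exists>H. induced_subgraph H G \<and> graph_iso F H)"

end

theory Submission
  imports Defs
begin

text \<open>
  By Ramsey's theorem an independent \<open>s\<close>-set has at most \<open>R = (r + t) ^ t\<close> common neighbours, so
  the number of pairs \<open>(v, S)\<close> with \<open>S\<close> an ordered independent \<open>s\<close>-set inside the neighbourhood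
  \<open>N v\<close> is at most \<open>R * n ^ s\<close>. On the other hand, dependent random choice with \<open>s\<^sup>2\<close> random
  vertices shows that in every vertex set of size at least of order \<open>R powr (1 + 1 / s) * (r + s) ^ s\<close>
  half of the vertices are non-adjacent to half of the set. Picking vertices greedily, a
  neighbourhood of size \<open>d\<close> above this threshold contains at least \<open>(d / 2 ^ s) ^ s\<close> ordered
  independent \<open>s\<close>-sets, which bounds the total degree of such vertices. A degree \<open>d\<close> below a
  threshold \<open>Q ^ s\<close> satisfies \<open>d \<le> Q * n powr (1 - 1 / s)\<close>, because \<open>d \<le> n\<close>.
\<close>

section \<open>Ramsey's theorem with a power bound\<close>

text \<open>Split the vertices other than some \<open>x\<close> into neighbours \<open>Y\<close> and
  non-neighbours \<open>Z\<close>. With \<open>z = p + q - 1\<close>, \<open>z ^ q + z ^ (q - 1) =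
  (z + 1) * z ^ (q - 1) \<le> (p + q) ^ q\<close>, so \<open>Y\<close> is large enough for
  \<open>(p - 1, q)\<close> or \<open>Z\<close> for \<open>(p, q - 1)\<close>. Then \<open>x\<close>
  extends the clique in \<open>Y\<close> or the independent set in \<open>Z\<close>.\<close>

lemma ramsey2_power_bound:
  fixes X :: "'a set"
  assumes "finite X" and "(p + q) ^ q \<le> card X"
  shows "(\<exists>K\<subseteq>X. card K = p \<and> clique K E) \<or> (\<exists>I\<subseteq>X. card I = q \<and> indep I E)"
  using assms
proof (induction "p + q" arbitrary: p q X)
  case 0
  then show ?case by (auto intro: exI[of _ "{}"])
next
  case (Suc z)
  show ?case
  proof (cases "p = 0 \<or> q = 0")
    case True
    then show ?thesis by (auto intro: exI[of _ "{}"])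
  next
    case False
    then obtain p' q' where pq: "p = Suc p'" "q = Suc q'"
      using not0_implies_Suc by blast
    have "card X \<noteq> 0" using Suc.prems(2) pq by (metis Suc.hyps(2) le_zero_eq nat.distinct(1) power_not_zero)
    then obtain x where x: "x \<in> X" by fastforce
    define Y where "Y = {y \<in> X - {x}. {x, y} \<in> E}"
    define Z where "Z = {y \<in> X - {x}. {x, y} \<notin> E}"
    have fin: "finite Y" "finite Z" and sub: "Y \<subseteq> X" "Z \<subseteq> X" "x \<notin> Y" "x \<notin> Z"
      using Suc.prems(1) by (auto simp: Y_def Z_def)
    have "X = insert x (Y \<union> Z)" "Y \<inter> Z = {}"
      using x by (auto simp: Y_def Z_def)
    then have card: "card X = Suc (card Y + card Z)"
      using fin sub card_Un_disjoint[of Y Z] by simp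
    have z: "z = p' + q" "z = p + q'" using Suc.hyps(2) pq by auto
    have "z ^ q + z ^ q' = Suc z * z ^ q'" using pq by simp
    also have "\<dots> \<le> Suc z * Suc z ^ q'" by (intro mult_left_mono power_mono) auto
    also have "\<dots> \<le> card X" using Suc.prems(2) Suc.hyps(2) pq by simp
    finally consider "z ^ q \<le> card Y" | "z ^ q' \<le> card Z" using card by linarith
    then show ?thesis
    proof cases
      case 1
      then have "(\<exists>K\<subseteq>Y. card K = p' \<and> clique K E) \<or> (\<exists>I\<subseteq>Y. card I = q \<and> indep I E)"
        using Suc.hyps(1)[OF z(1) fin(1)] z by simp
      then show ?thesis
      proof
        assume "\<exists>K\<subseteq>Y. card K = p' \<and> clique K E"
        then obtain K where K: "K \<subseteq> Y" "card K = p'" "clique K E" by blast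
        have "card (insert x K) = p"
          using K sub fin pq by (metis card_insert_disjoint finite_subset subsetD)
        moreover have "clique (insert x K) E"
          using K by (fastforce simp: clique_def Y_def insert_commute)
        ultimately show ?thesis using K sub x by (intro disjI1 exI[of _ "insert x K"]) auto
      qed (use sub in blast)
    next
      case 2
      then have "(\<exists>K\<subseteq>Z. card K = p \<and> clique K E) \<or> (\<exists>I\<subseteq>Z. card I = q' \<and> indep I E)"
        using Suc.hyps(1)[OF z(2) fin(2)] z by simp
      then show ?thesis
      proof
        assume "\<exists>I\<subseteq>Z. card I = q' \<and> indep I E"
        then obtain I where I: "I \<subseteq> Z" "card I = q'" "indep I E" by blast
        have "card (insert x I) = q"
          using I sub fin pq by (metis card_insert_disjoint finite_subset subsetD)
        moreover have "indep (insert x I) E"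
          using I by (fastforce simp: indep_def Z_def insert_commute)
        ultimately show ?thesis using I sub x by (intro disjI2 exI[of _ "insert x I"]) auto
      qed (use sub in blast)
    qed
  qed
qed

section \<open>Double counting of tuples and common neighbours\<close>

lemma sum_card_swap:
  assumes "finite A" "finite B"
  shows "(\<Sum>x\<in>A. card {y \<in> B. P x y}) = (\<Sum>y\<in>B. card {x \<in> A. P x y})"
proof -
  have "(\<Sum>x\<in>A. card {y \<in> B. P x y}) = (\<Sum>x\<in>A. \<Sum>y\<in>B. if P x y then 1 else 0)"
    using assms by (simp add: sum.inter_filter[symmetric])
  also have "\<dots> = (\<Sum>y\<in>B. \<Sum>x\<in>A. if P x y then 1 else 0)" by (rule sum.swap)
  also have "\<dots> = (\<Sum>y\<in>B. card {x \<in> A. P x y})"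
    using assms by (simp add: sum.inter_filter[symmetric])
  finally show ?thesis .
qed

definition common_nbrs :: "'a set set \<Rightarrow> 'a set \<Rightarrow> 'a set \<Rightarrow> 'a set" where
  "common_nbrs E W S = {w \<in> W. \<forall>x\<in>S. {x, w} \<in> E}"

text \<open>Repetitions are allowed, so these lists are the outcomes of \<open>k\<close> independent
  uniform draws from \<open>W\<close>; sums over them stand for expectations.\<close>

definition lists_of :: "'a set \<Rightarrow> nat \<Rightarrow> 'a list set" where
  "lists_of W k = {xs. set xs \<subseteq> W \<and> length xs = k}"

text \<open>Ordering the independent sets makes vertex-by-vertex construction injective and avoids
  binomial coefficients.\<close>

definition indep_lists :: "'a set set \<Rightarrow> 'a set \<Rightarrow> nat \<Rightarrow> 'a list set" where
  "indep_lists E W k = {xs \<in> lists_of W k. distinct xs \<and> indep (set xs) E}"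

lemma finite_lists_of: "finite W \<Longrightarrow> finite (lists_of W k)"
  and card_lists_of: "finite W \<Longrightarrow> card (lists_of W k) = card W ^ k"
  unfolding lists_of_def by (simp_all add: finite_lists_length_eq card_lists_length_eq)

lemma finite_indep_lists: "finite W \<Longrightarrow> finite (indep_lists E W k)"
  unfolding indep_lists_def by (simp add: finite_lists_of)

lemma card_indep_lists_le: "finite W \<Longrightarrow> card (indep_lists E W k) \<le> card W ^ k"
  unfolding indep_lists_def card_lists_of[symmetric]
  by (intro card_mono finite_lists_of) auto

lemma common_nbrs_subset: "common_nbrs E W S \<subseteq> W"
  by (auto simp: common_nbrs_def)

lemma finite_common_nbrs: "finite W \<Longrightarrow> finite (common_nbrs E W S)"
  by (rule finite_subset[OF common_nbrs_subset])

text \<open>Both sides count pairs \<open>(T, x)\<close> with \<open>x\<close> adjacent to every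
  entry of \<open>T\<close>: for fixed \<open>x\<close>, these \<open>T\<close> are the
  \<open>k\<close>-tuples of neighbours of \<open>x\<close>.\<close>

lemma sum_card_common_nbrs:
  assumes "finite W"
  shows "(\<Sum>T\<in>lists_of W k. card (common_nbrs E W (set T))) =
    (\<Sum>x\<in>W. card (common_nbrs E W {x}) ^ k)"
proof -
  have "(\<Sum>T\<in>lists_of W k. card (common_nbrs E W (set T))) =
     (\<Sum>x\<in>W. card {T \<in> lists_of W k. \<forall>y\<in>set T. {y, x} \<in> E})"
    unfolding common_nbrs_def using assms by (intro sum_card_swap finite_lists_of)
  also have "\<dots> = (\<Sum>x\<in>W. card (lists_of (common_nbrs E W {x}) k))"
    by (intro sum.cong arg_cong[where f = card])
       (auto simp: lists_of_def common_nbrs_def insert_commute)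
  also have "\<dots> = (\<Sum>x\<in>W. card (common_nbrs E W {x}) ^ k)"
    using assms by (simp add: card_lists_of finite_common_nbrs)
  finally show ?thesis .
qed

text \<open>Adjacency is symmetric: \<open>xs\<close> lies in the common neighbourhood of
  \<open>T\<close> exactly when \<open>T\<close> lies in that of \<open>xs\<close>.\<close>

lemma sum_card_indep_lists_common_nbrs:
  assumes "finite W"
  shows "(\<Sum>T\<in>lists_of W k. card (indep_lists E (common_nbrs E W (set T)) s)) =
    (\<Sum>xs\<in>indep_lists E W s. card (common_nbrs E W (set xs)) ^ k)"
proof -
  have "(\<Sum>T\<in>lists_of W k. card (indep_lists E (common_nbrs E W (set T)) s)) =
      (\<Sum>T\<in>lists_of W k. card {xs \<in> indep_lists E W s. \<forall>y\<in>set T. \<forall>x\<in>set xs. {y, x} \<in> E})"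
    by (intro sum.cong arg_cong[where f = card])
       (auto simp: lists_of_def indep_lists_def common_nbrs_def)
  also have "\<dots> = (\<Sum>xs\<in>indep_lists E W s. card {T \<in> lists_of W k. \<forall>y\<in>set T. \<forall>x\<in>set xs. {y, x} \<in> E})"
    using assms by (intro sum_card_swap finite_lists_of finite_indep_lists)
  also have "\<dots> = (\<Sum>xs\<in>indep_lists E W s. card (lists_of (common_nbrs E W (set xs)) k))"
    by (intro sum.cong arg_cong[where f = card])
       (auto simp: lists_of_def indep_lists_def common_nbrs_def insert_commute)
  also have "\<dots> = (\<Sum>xs\<in>indep_lists E W s. card (common_nbrs E W (set xs)) ^ k)"
    using assms by (simp add: card_lists_of finite_common_nbrs)
  finally show ?thesis .
qed

lemma sum_card_indep_lists_nbrs: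
  assumes "finite W"
  shows "(\<Sum>v\<in>W. card (indep_lists E (common_nbrs E W {v}) s)) =
    (\<Sum>xs\<in>indep_lists E W s. card (common_nbrs E W (set xs)))"
proof -
  have "(\<Sum>v\<in>W. card (indep_lists E (common_nbrs E W {v}) s)) =
      (\<Sum>v\<in>W. card {xs \<in> indep_lists E W s. \<forall>x\<in>set xs. {x, v} \<in> E})"
    by (intro sum.cong arg_cong[where f = card])
       (auto simp: lists_of_def indep_lists_def common_nbrs_def insert_commute)
  also have "\<dots> = (\<Sum>xs\<in>indep_lists E W s. card (common_nbrs E W (set xs)))"
    unfolding common_nbrs_def using assms by (intro sum_card_swap finite_indep_lists)
  finally show ?thesis .
qed

text \<open>Handshake lemma: neighbours of \<open>v\<close> correspond to edges at \<open>v\<close>,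
  and each edge has two endpoints.\<close>

lemma sum_card_nbrs:
  assumes "finite V" "E \<subseteq> nsets V 2"
  shows "(\<Sum>v\<in>V. card (common_nbrs E V {v})) = 2 * card E"
proof -
  have finE: "finite E" using assms finite_imp_finite_nsets finite_subset by blast
  have two: "card {v \<in> V. v \<in> e} = 2" if "e \<in> E" for e
  proof -
    have "{v \<in> V. v \<in> e} = e" "card e = 2" using that assms by (auto simp: nsets_def)
    then show ?thesis by simp
  qed
  have "card (common_nbrs E V {v}) = card {e \<in> E. v \<in> e}" for v
  proof (rule bij_betw_same_card[of "\<lambda>w. {v, w}"])
    have "{e \<in> E. v \<in> e} \<subseteq> (\<lambda>w. {v, w}) ` common_nbrs E V {v}"
    proof
      fix e assume "e \<in> {e \<in> E. v \<in> e}"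
      moreover from this obtain x y where "e = {x, y}" "x \<in> V" "y \<in> V"
        using assms(2) by (blast elim: nsets2_E)
      ultimately show "e \<in> (\<lambda>w. {v, w}) ` common_nbrs E V {v}"
        by (auto simp: common_nbrs_def insert_commute)
    qed
    then show "bij_betw (\<lambda>w. {v, w}) (common_nbrs E V {v}) {e \<in> E. v \<in> e}"
      by (auto simp: bij_betw_def inj_on_def common_nbrs_def doubleton_eq_iff)
  qed
  then have "(\<Sum>v\<in>V. card (common_nbrs E V {v})) = (\<Sum>e\<in>E. card {v \<in> V. v \<in> e})"
    using sum_card_swap[OF assms(1) finE, of "(\<in>)"] by simp
  then show ?thesis using two by simp
qed

section \<open>Graphs with no \<open>r\<close>-clique and no induced biclique\<close>

text \<open>The forbidden copies are phrased through vertex sets. Disjointness of \<open>A\<close>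
  and \<open>B\<close> is implicit in complete adjacency, since a common element would be a
  loop.\<close>

locale clique_biclique_free =
  fixes V :: "'a set" and E :: "'a set set" and r s t :: nat
  assumes finite_V: "finite V"
    and loopless: "\<And>x. {x} \<notin> E"
    and no_clique: "\<And>K. K \<subseteq> V \<Longrightarrow> card K = r \<Longrightarrow> \<not> clique K E"
    and no_biclique: "\<And>A B. \<lbrakk>A \<subseteq> V; B \<subseteq> V; card A = s; card B = t; indep A E; indep B E;
      \<forall>a\<in>A. \<forall>b\<in>B. {a, b} \<in> E\<rbrakk> \<Longrightarrow> False"
    and s_pos: "s \<ge> 1"
begin

lemma finite_sub: "W \<subseteq> V \<Longrightarrow> finite W"
  using finite_V finite_subset by blast

lemma exists_indep:
  assumes "W \<subseteq> V" "(r + q) ^ q \<le> card W"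
  obtains I where "I \<subseteq> W" "card I = q" "indep I E"
proof -
  from ramsey2_power_bound[OF finite_sub[OF assms(1)] assms(2), of E] show thesis
  proof (elim disjE exE conjE)
    fix K assume "K \<subseteq> W" "card K = r" "clique K E"
    with no_clique[of K] assms(1) show thesis by (simp add: subset_trans[of K W V])
  qed (rule that)
qed

text \<open>Otherwise Ramsey's theorem finds an independent \<open>t\<close>-set among the common
  neighbours, which together with \<open>xs\<close> spans an induced biclique.\<close>

lemma card_common_nbrs_indep:
  assumes "W \<subseteq> V" "xs \<in> indep_lists E W s"
  shows "card (common_nbrs E W (set xs)) \<le> (r + t) ^ t"
proof (rule ccontr)
  assume "\<not> ?thesis"
  then have "(r + t) ^ t \<le> card (common_nbrs E W (set xs))" by linarith
  moreover have "common_nbrs E W (set xs) \<subseteq> V" using common_nbrs_subset assms(1) by (rule order_trans)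
  ultimately obtain I where I: "I \<subseteq> common_nbrs E W (set xs)" "card I = t" "indep I E"
    using exists_indep by blast
  have xs: "set xs \<subseteq> W" "length xs = s" "distinct xs" "indep (set xs) E"
    using assms(2) by (simp_all add: indep_lists_def lists_of_def)
  show False
  proof (rule no_biclique[of "set xs" I])
    show "card (set xs) = s" using xs by (simp add: distinct_card)
    show "set xs \<subseteq> V" using xs assms(1) by blast
    show "I \<subseteq> V" using I common_nbrs_subset assms(1) by fast
    show "\<forall>a\<in>set xs. \<forall>b\<in>I. {a, b} \<in> E" using I by (auto simp: common_nbrs_def)
  qed (fact xs I)+
qed

section \<open>Supersaturation and dependent random choice\<close>

text \<open>While at least \<open>(r + s) ^ s\<close> vertices remain, some independent
  \<open>s\<close>-set exists. Deleting one of its vertices destroys at least one list, so the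
  deletions made are at most as many as the lists.\<close>

lemma card_le_card_indep_lists:
  assumes "W \<subseteq> V"
  shows "card W \<le> card (indep_lists E W s) + (r + s) ^ s"
  using finite_sub[OF assms] assms
proof (induction W rule: finite_psubset_induct)
  case (psubset W)
  show ?case
  proof (cases "(r + s) ^ s \<le> card W")
    case True
    then obtain I where I: "I \<subseteq> W" "card I = s" "indep I E"
      using exists_indep psubset.prems by blast
    then have "finite I" using psubset.hyps finite_subset by blast
    then obtain xs where "distinct xs" "set xs = I"
      using finite_distinct_list by blast
    with I have xs: "xs \<in> indep_lists E W s"
      by (auto simp: indep_lists_def lists_of_def distinct_card)
    obtain x where x: "x \<in> set xs" "x \<in> W"
      using xs s_pos by (cases xs) (auto simp: indep_lists_def lists_of_def)
    have IH: "card (W - {x}) \<le> card (indep_lists E (W - {x}) s) + (r + s) ^ s"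
      using x psubset by (intro psubset.IH) auto
    have "indep_lists E (W - {x}) s \<subset> indep_lists E W s"
      using x xs by (auto simp: indep_lists_def lists_of_def)
    then have "card (indep_lists E (W - {x}) s) < card (indep_lists E W s)"
      using psubset.hyps by (intro psubset_card_mono finite_indep_lists)
    moreover have "card W = Suc (card (W - {x}))"
      using x psubset.hyps by (metis card_Suc_Diff1)
    ultimately show ?thesis using IH by linarith
  qed simp
qed

text \<open>Dependent random choice: the common neighbourhood of a random \<open>k\<close>-tuple would be large,
  hence contain many independent \<open>s\<close>-sets, each of which has few common neighbours.\<close>

lemma sum_degree_power_le:
  assumes "W \<subseteq> V"
  shows "(\<Sum>x\<in>W. card (common_nbrs E W {x}) ^ k) \<le>
    card W ^ s * ((r + t) ^ t) ^ k + card W ^ k * (r + s) ^ s"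
proof -
  note fin = finite_sub[OF assms]
  have "(\<Sum>x\<in>W. card (common_nbrs E W {x}) ^ k)
      = (\<Sum>T\<in>lists_of W k. card (common_nbrs E W (set T)))"
    using fin by (simp add: sum_card_common_nbrs)
  also have "\<dots> \<le> (\<Sum>T\<in>lists_of W k.
      card (indep_lists E (common_nbrs E W (set T)) s) + (r + s) ^ s)"
    by (intro sum_mono card_le_card_indep_lists order_trans[OF common_nbrs_subset assms])
  also have "\<dots> = (\<Sum>xs\<in>indep_lists E W s. card (common_nbrs E W (set xs)) ^ k)
      + card W ^ k * (r + s) ^ s"
    using fin by (simp add: sum.distrib sum_card_indep_lists_common_nbrs card_lists_of)
  also have "\<dots> \<le> (\<Sum>xs\<in>indep_lists E W s. ((r + t) ^ t) ^ k) + card W ^ k * (r + s) ^ s"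
    using assms by (intro add_right_mono sum_mono power_mono card_common_nbrs_indep) auto
  also have "\<dots> \<le> card W ^ s * ((r + t) ^ t) ^ k + card W ^ k * (r + s) ^ s"
    unfolding sum_constant of_nat_id using fin
    by (intro add_right_mono mult_right_mono card_indep_lists_le) auto
  finally show ?thesis .
qed

section \<open>Sparse vertices and greedy choice of independent tuples\<close>

text \<open>Leaving out \<open>u\<close> keeps \<open>u # xs\<close> distinct for every distinct
  list \<open>xs\<close> of non-neighbours.\<close>

definition non_nbrs :: "'a set \<Rightarrow> 'a \<Rightarrow> 'a set" where
  "non_nbrs W u = {w \<in> W. w \<noteq> u \<and> {u, w} \<notin> E}"

lemma card_nbrs_non_nbrs:
  assumes "W \<subseteq> V" "u \<in> W"
  shows "card W = Suc (card (common_nbrs E W {u}) + card (non_nbrs W u))"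
proof -
  have "card W = card (insert u (common_nbrs E W {u} \<union> non_nbrs W u))"
    using assms by (intro arg_cong[where f = card]) (auto simp: non_nbrs_def common_nbrs_def)
  moreover have "common_nbrs E W {u} \<inter> non_nbrs W u = {}" "u \<notin> common_nbrs E W {u} \<union> non_nbrs W u"
    using loopless by (auto simp: non_nbrs_def common_nbrs_def)
  moreover have "finite (common_nbrs E W {u})" "finite (non_nbrs W u)"
    using finite_sub[OF assms(1)] by (auto simp: non_nbrs_def finite_common_nbrs)
  ultimately show ?thesis by (simp add: card_Un_disjoint)
qed

text \<open>Otherwise more than half of \<open>W\<close> has degree at least
  \<open>card W / 4\<close> inside \<open>W\<close>, and the sum of the \<open>s\<^sup>2\<close>-th
  powers of the degrees exceeds the bound from dependent random choice. The number \<open>a\<close>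
  is the real \<open>s\<close>-th root of the Ramsey bound.\<close>

lemma half_sparse:
  fixes a :: real
  assumes W: "W \<subseteq> V" and a: "a \<ge> 1" "a ^ s = real ((r + t) ^ t)"
    and m: "real (card W) \<ge> 4 ^ (s\<^sup>2 + 1) * real (r + s) ^ s * a ^ (s + 1)"
  shows "card W \<le> 2 * card {u \<in> W. card W \<le> 2 * card (non_nbrs W u)}"
proof (rule ccontr)
  assume neg: "\<not> ?thesis"
  define H where "H = {u \<in> W. \<not> card W \<le> 2 * card (non_nbrs W u)}"
  define m where "m = real (card W)"
  define k where "k = s\<^sup>2"
  define M where "M = real (r + s) ^ s"
  note fin = finite_sub[OF W]
  have M1: "M \<ge> 1" unfolding M_def using s_pos by (intro one_le_power) simp
  have k: "k \<ge> s" "k \<ge> 1" using s_pos by (simp_all add: k_def power2_eq_square)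
  have m_ge: "m \<ge> 4 ^ (k + 1) * M * a ^ (s + 1)" using m by (simp add: m_def k_def M_def)
  have a_pow: "a ^ j \<ge> 1" for j using a by (simp add: one_le_power)
  have m_ge1: "m \<ge> 4 ^ (k + 1) * M"
  proof -
    have "4 ^ (k + 1) * M * 1 \<le> 4 ^ (k + 1) * M * a ^ (s + 1)"
      using M1 a_pow[of "s+1"] by (intro mult_left_mono) auto
    then show ?thesis using m_ge by linarith
  qed
  have m_ge2: "m \<ge> 4 ^ (k + 1)"
  proof -
    have "(4::real) ^ (k + 1) * 1 \<le> 4 ^ (k + 1) * M" using M1 by (intro mult_left_mono) auto
    then show ?thesis using m_ge1 by linarith
  qed
  moreover have "(4::real) \<le> 4 ^ (k + 1)" by (intro self_le_power) auto
  ultimately have m4: "m \<ge> 4" by linarith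
  have H_half: "2 * real (card H) > m"
  proof -
    have "card W = card {u \<in> W. card W \<le> 2 * card (non_nbrs W u)} + card H"
      using fin by (subst card_Un_disjoint[symmetric]) (auto simp: H_def intro!: arg_cong[where f = card])
    then show ?thesis using neg by (simp add: m_def)
  qed
  \<comment> \<open>The vertex \<open>u\<close> itself costs one, giving only
    \<open>m \<le> 2 * deg + 1\<close>; with \<open>m \<ge> 4\<close> this yields
    \<open>m / 4\<close>.\<close>
  have deg: "m / 4 \<le> real (card (common_nbrs E W {u}))" if "u \<in> H" for u
  proof -
    have "u \<in> W" "2 * card (non_nbrs W u) < card W" using that by (auto simp: H_def)
    then have "card W \<le> 2 * card (common_nbrs E W {u}) + 1"
      using card_nbrs_non_nbrs[OF W, of u] by linarith
    then have "card W \<le> 4 * card (common_nbrs E W {u})" using m4 by (simp add: m_def)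
    then show ?thesis by (simp add: m_def)
  qed
  have "m / 2 * (m / 4) ^ k < real (card H) * (m / 4) ^ k"
    using H_half m4 by (intro mult_strict_right_mono) auto
  also have "\<dots> \<le> (\<Sum>u\<in>H. real (card (common_nbrs E W {u})) ^ k)"
    using deg m4 by (intro sum_bounded_below power_mono) auto
  also have "\<dots> \<le> (\<Sum>u\<in>W. real (card (common_nbrs E W {u})) ^ k)"
    using fin by (intro sum_mono2) (auto simp: H_def)
  also have "\<dots> = real (\<Sum>u\<in>W. card (common_nbrs E W {u}) ^ k)" by simp
  also have "\<dots> \<le> real (card W ^ s * ((r + t) ^ t) ^ k + card W ^ k * (r + s) ^ s)"
    using sum_degree_power_le[OF W] by (intro of_nat_mono)
  also have "\<dots> = m ^ s * (a ^ s) ^ k + m ^ k * M"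
    by (simp add: m_def a M_def)
  finally have "m / 2 * (m / 4) ^ k < m ^ s * (a ^ s) ^ k + m ^ k * M" .
  \<comment> \<open>The supersaturation error takes at most half of the left side, so the other half
    must lie below the main term.\<close>
  moreover have "m ^ k * M \<le> m * (m / 4) ^ k / 4"
  proof -
    have "m ^ k * (4 ^ (k + 1) * M) \<le> m ^ k * m" using m_ge1 m4 by (intro mult_left_mono) auto
    then show ?thesis by (simp add: power_divide field_simps)
  qed
  ultimately have "m * (m / 4) ^ k / 4 < m ^ s * (a ^ s) ^ k" by linarith
  then have "m ^ (k + 1) < 4 ^ (k + 1) * (m ^ s * (a ^ s) ^ k)"
    by (simp add: power_divide field_simps)
  also have "m ^ (k + 1) = m ^ s * m ^ (k + 1 - s)"
    using k by (metis le_add_diff_inverse power_add trans_le_add1)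
  finally have "m ^ (k + 1 - s) < 4 ^ (k + 1) * (a ^ s) ^ k"
    using m4 by (simp add: mult.left_commute)
  moreover have "4 ^ (k + 1) * (a ^ s) ^ k \<le> m ^ (k + 1 - s)"
  proof -
    \<comment> \<open>This explains \<open>k = s\<^sup>2\<close>:
      \<open>(s + 1) * (s\<^sup>2 + 1 - s) = s ^ 3 + 1\<close> just exceeds
      \<open>s * k = s ^ 3\<close>, so a factor \<open>a ^ (s + 1)\<close> in the size of
      \<open>W\<close> suffices.\<close>
    have le: "s * k \<le> (s + 1) * (k + 1 - s)"
    proof -
      have "int ((s + 1) * (k + 1 - s)) = int (s * k) + 1"
        using k by (simp add: k_def of_nat_diff algebra_simps power2_eq_square)
      then show ?thesis by linarith
    qed
    have "4 ^ (k + 1) * (a ^ s) ^ k \<le> 4 ^ (k + 1) * (a ^ (s + 1)) ^ (k + 1 - s)"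
      unfolding power_mult[symmetric] using power_increasing[OF le a(1)] by (intro mult_left_mono) auto
    also have "(4::real) ^ (k + 1) * (a ^ (s + 1)) ^ (k + 1 - s)
        \<le> (4 ^ (k + 1)) ^ (k + 1 - s) * (a ^ (s + 1)) ^ (k + 1 - s)"
      using a k by (intro mult_right_mono self_le_power one_le_power) auto
    also have "\<dots> = (4 ^ (k + 1) * 1 * a ^ (s + 1)) ^ (k + 1 - s)" by (simp add: power_mult_distrib)
    also have "\<dots> \<le> (4 ^ (k + 1) * M * a ^ (s + 1)) ^ (k + 1 - s)"
      using M1 a by (intro power_mono mult_right_mono mult_left_mono) auto
    also have "\<dots> \<le> m ^ (k + 1 - s)" using m_ge M1 a by (intro power_mono) auto
    finally show ?thesis .
  qed
  ultimately show False by linarith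
qed

text \<open>Prepending \<open>u\<close> to an independent list of its non-neighbours keeps it
  independent, and the head recovers \<open>u\<close>.\<close>

lemma card_indep_lists_Suc:
  assumes "W \<subseteq> V" "U \<subseteq> W"
  shows "(\<Sum>u\<in>U. card (indep_lists E (non_nbrs W u) j)) \<le> card (indep_lists E W (Suc j))"
proof -
  have fin: "finite W" "finite U" using assms finite_sub finite_subset by blast+
  have finN: "finite (non_nbrs W u)" for u using fin by (simp add: non_nbrs_def)
  have "(\<Sum>u\<in>U. card (indep_lists E (non_nbrs W u) j))
      = card (SIGMA u:U. indep_lists E (non_nbrs W u) j)"
    using fin finN by (intro card_SigmaI[symmetric] ballI finite_indep_lists)
  also have "\<dots> \<le> card (indep_lists E W (Suc j))"
  proof (rule card_inj_on_le[where f = "\<lambda>(u, xs). u # xs"])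
    show "(\<lambda>(u, xs). u # xs) ` (SIGMA u:U. indep_lists E (non_nbrs W u) j) \<subseteq> indep_lists E W (Suc j)"
      using assms by (fastforce simp: indep_lists_def lists_of_def non_nbrs_def indep_def insert_commute)
  qed (use fin in \<open>auto simp: inj_on_def finite_indep_lists\<close>)
  finally show ?thesis .
qed

text \<open>At least half of \<open>W\<close> can serve as first entry while leaving at least half
  of \<open>W\<close> as non-neighbours for the rest. The factor \<open>2 ^ j\<close> keeps the set
  above the threshold of \<open>half_sparse\<close> throughout. Indexing by \<open>j + 1\<close>
  starts the induction at singleton lists.\<close>

lemma many_indep_lists:
  fixes a :: real
  assumes a: "a \<ge> 1" "a ^ s = real ((r + t) ^ t)"
    and W: "W \<subseteq> V" "2 ^ j * (4 ^ (s\<^sup>2 + 1) * real (r + s) ^ s * a ^ (s + 1)) \<le> real (card W)"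
  shows "(real (card W) / 2 ^ (j + 1)) ^ (j + 1) \<le> real (card (indep_lists E W (j + 1)))"
  using W
proof (induction j arbitrary: W)
  case 0
  have "indep_lists E W (0 + 1) = (\<lambda>x. [x]) ` W"
    by (auto simp: indep_lists_def lists_of_def indep_def length_Suc_conv)
  then have "card (indep_lists E W (0 + 1)) = card W" by (simp add: card_image inj_on_def)
  then show ?case by simp
next
  case (Suc j)
  define m0 where "m0 = 4 ^ (s\<^sup>2 + 1) * real (r + s) ^ s * a ^ (s + 1)"
  define m where "m = real (card W)"
  define U where "U = {u \<in> W. card W \<le> 2 * card (non_nbrs W u)}"
  have m0: "m0 \<ge> 0" using a by (simp add: m0_def)
  have m: "2 * (2 ^ j * m0) \<le> m" using Suc.prems by (simp add: m_def m0_def mult.assoc)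
  have "1 * m0 \<le> 2 ^ Suc j * m0" using m0 by (intro mult_right_mono one_le_power) auto
  also have "\<dots> \<le> m" using m by simp
  finally have "card W \<le> 2 * card U"
    unfolding U_def using half_sparse[OF Suc.prems(1) a] by (simp add: m_def m0_def)
  then have U: "m / 2 \<le> real (card U)" by (simp add: m_def)
  have step: "(m / 2 / 2 ^ (j + 1)) ^ (j + 1) \<le> real (card (indep_lists E (non_nbrs W u) (j + 1)))"
    if "u \<in> U" for u
  proof -
    have half: "m / 2 \<le> real (card (non_nbrs W u))" using that by (simp add: U_def m_def)
    have "(m / 2 / 2 ^ (j + 1)) ^ (j + 1) \<le> (real (card (non_nbrs W u)) / 2 ^ (j + 1)) ^ (j + 1)"
      using half by (intro power_mono divide_right_mono) (auto simp: m_def)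
    also have "\<dots> \<le> real (card (indep_lists E (non_nbrs W u) (j + 1)))"
      using half m Suc.prems(1) by (intro Suc.IH) (auto simp: non_nbrs_def m0_def)
    finally show ?thesis .
  qed
  have "(m / 2 ^ (Suc j + 1)) ^ (Suc j + 1) = (m / 2 ^ (Suc j + 1)) * (m / 2 / 2 ^ (j + 1)) ^ (j + 1)"
    by simp
  \<comment> \<open>The count \<open>m / 2\<close> of first entries is deliberately weakened to
    \<open>m / 2 ^ (j + 2)\<close>, so that the bound is a pure power.\<close>
  also have "\<dots> \<le> (m / 2) * (m / 2 / 2 ^ (j + 1)) ^ (j + 1)"
  proof (intro mult_right_mono)
    have "(2::real) ^ 1 \<le> 2 ^ (Suc j + 1)" by (intro power_increasing) auto
    then show "m / 2 ^ (Suc j + 1) \<le> m / 2" by (intro divide_left_mono) (auto simp: m_def)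
  qed (simp add: m_def)
  also have "\<dots> \<le> real (card U) * (m / 2 / 2 ^ (j + 1)) ^ (j + 1)"
    using U by (intro mult_right_mono) (auto simp: m_def)
  also have "\<dots> \<le> (\<Sum>u\<in>U. real (card (indep_lists E (non_nbrs W u) (j + 1))))"
    using step by (intro sum_bounded_below)
  also have "\<dots> = real (\<Sum>u\<in>U. card (indep_lists E (non_nbrs W u) (j + 1)))" by simp
  also have "\<dots> \<le> real (card (indep_lists E W (Suc j + 1)))"
    using card_indep_lists_Suc[OF Suc.prems(1), of U "j + 1"] by (intro of_nat_mono) (auto simp: U_def)
  finally show ?case by (simp add: m_def)
qed

section \<open>Bounding the sum of degrees\<close>

text \<open>The reals \<open>a\<close>, \<open>D\<close>, \<open>b\<close> stand for roots of
  \<open>(r + t) ^ t\<close>, \<open>a ^ (s + 1)\<close> and \<open>n ^ (s - 1)\<close>; fixing them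
  by their \<open>s\<close>-th powers keeps real exponents out of the argument. Degrees up to
  \<open>Q ^ s\<close> are bounded individually, larger ones on average through their independent
  lists.\<close>

lemma sum_degree_le:
  fixes a D b :: real
  assumes a: "a \<ge> 1" "a ^ s = real ((r + t) ^ t)"
    and D: "D \<ge> 0" "D ^ s = a ^ (s + 1)"
    and b: "b \<ge> 0" "b ^ s = real (card V) ^ (s - 1)"
    and V: "V \<noteq> {}"
  shows "(\<Sum>v\<in>V. real (card (common_nbrs E V {v})))
    \<le> real (card V) * b * (4 * 4 ^ s * D * real (r + s) + 2 * 2 ^ s * a)"
proof -
  define n where "n = real (card V)"
  define d where "d v = real (card (common_nbrs E V {v}))" for v
  define Q where "Q = 4 * 4 ^ s * D * real (r + s)"
  \<comment> \<open>Balanced choice: \<open>n * c ^ s = n ^ s * a ^ s * 2 ^ (s * s)\<close>, so the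
    list terms sum to at most \<open>n * c\<close>, the same as the cut-off terms.\<close>
  define c where "c = 2 ^ s * a * b"
  have n: "n > 0" using V finite_V by (simp add: n_def card_gt_0_iff)
  have Q: "Q \<ge> 0" using D by (simp add: Q_def)
  have s: "Suc (s - 1) = s" and s': "s - 1 + 1 = s" using s_pos by simp_all
  have "b \<noteq> 0" using b(2) n s_pos by (auto simp: n_def power_0_left)
  then have c: "c > 0" using a b by (simp add: c_def)
  have d_le: "d v \<le> n" "d v \<ge> 0" for v
    using card_mono[OF finite_V common_nbrs_subset] by (simp_all add: d_def n_def)
  have threshold: "2 ^ (s - 1) * (4 ^ (s\<^sup>2 + 1) * real (r + s) ^ s * a ^ (s + 1)) \<le> Q ^ s"
  proof -
    \<comment> \<open>The \<open>s - 1\<close> halvings and the extra factor 4 of the threshold fit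
      into \<open>4 ^ s\<close> because \<open>s + 1 \<le> 2 * s\<close>.\<close>
    have "(2::real) ^ (s - 1) * 4 \<le> 4 ^ s"
    proof -
      have "(2::real) ^ (s - 1) * 4 = 2 ^ (s - 1 + 2)" by (simp only: power_add) simp
      also have "\<dots> \<le> 2 ^ (2 * s)" using s_pos by (intro power_increasing) auto
      finally show ?thesis by (simp add: power_mult)
    qed
    then have "2 ^ (s - 1) * 4 * (4 ^ s\<^sup>2 * real (r + s) ^ s * a ^ (s + 1))
      \<le> 4 ^ s * (4 ^ s\<^sup>2 * real (r + s) ^ s * a ^ (s + 1))"
      using a by (intro mult_right_mono) auto
    also have "\<dots> = Q ^ s"
      by (simp add: Q_def power_mult_distrib D(2) power_mult[symmetric] power2_eq_square)
    finally show ?thesis by (simp add: mult_ac)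
  qed
  \<comment> \<open>The cut-off \<open>c\<close> replaces the power mean inequality: \<open>d \<le> c + d ^ s / c ^ (s - 1)\<close>.\<close>
  have main: "d v \<le> Q * b + c + real (card (indep_lists E (common_nbrs E V {v}) s)) * 2 ^ (s * s) / c ^ (s - 1)"
    (is "_ \<le> _ + _ + ?X v") for v
  proof (cases "d v \<le> Q ^ s")
    case True
    have "d v ^ s = d v * d v ^ (s - 1)" by (metis s power_Suc)
    also have "\<dots> \<le> Q ^ s * n ^ (s - 1)"
      using True d_le[of v] Q by (intro mult_mono power_mono) auto
    also have "\<dots> = (Q * b) ^ s" by (simp add: power_mult_distrib b n_def)
    finally have "d v \<le> Q * b"
      using Q b s_pos by (metis mult_nonneg_nonneg power_le_imp_le_base s)
    moreover have "?X v \<ge> 0" using c by simp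
    ultimately show ?thesis using c by linarith
  next
    case False
    have "(d v / 2 ^ s) ^ s \<le> real (card (indep_lists E (common_nbrs E V {v}) s))"
      unfolding d_def
      using False threshold by (intro many_indep_lists[OF a, of _ "s - 1", unfolded s'])
        (auto simp: common_nbrs_subset d_def)
    then have X: "d v ^ s \<le> real (card (indep_lists E (common_nbrs E V {v}) s)) * 2 ^ (s * s)"
      by (simp add: power_divide power_mult field_simps)
    have X0: "?X v \<ge> 0" using c by simp
    have "d v \<le> c + ?X v"
    proof (cases "d v \<le> c")
      case True
      then show ?thesis using X0 by simp
    next
      case False
      then have "d v * c ^ (s - 1) \<le> d v * d v ^ (s - 1)"
        using c d_le by (intro mult_left_mono power_mono) auto
      also have "\<dots> = d v ^ s" by (metis s power_Suc)
      finally have "d v * c ^ (s - 1) \<le> real (card (indep_lists E (common_nbrs E V {v}) s)) * 2 ^ (s * s)"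
        using X by linarith
      then have "d v \<le> ?X v" using c by (simp add: field_simps)
      then show ?thesis using c by simp
    qed
    moreover have "Q * b \<ge> 0" using Q b by simp
    ultimately show ?thesis by linarith
  qed
  \<comment> \<open>Count pairs of a vertex and a list in its neighbourhood from the side of the
    lists: at most \<open>n ^ s\<close> lists, each with at most \<open>a ^ s\<close> common
    neighbours.\<close>
  have "(\<Sum>v\<in>V. real (card (indep_lists E (common_nbrs E V {v}) s)))
      = real (\<Sum>xs\<in>indep_lists E V s. card (common_nbrs E V (set xs)))"
    unfolding sum_card_indep_lists_nbrs[OF finite_V, symmetric] by simp
  also have "\<dots> \<le> real (\<Sum>xs\<in>indep_lists E V s. (r + t) ^ t)"
    by (intro of_nat_mono sum_mono card_common_nbrs_indep) auto
  also have "\<dots> = real (card (indep_lists E V s)) * a ^ s" by (simp add: a)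
  also have "\<dots> \<le> n ^ s * a ^ s"
  proof (intro mult_right_mono)
    show "real (card (indep_lists E V s)) \<le> n ^ s"
      unfolding n_def using card_indep_lists_le[OF finite_V] by (metis of_nat_mono of_nat_power)
  qed (use a in simp)
  finally have count: "(\<Sum>v\<in>V. real (card (indep_lists E (common_nbrs E V {v}) s))) \<le> n ^ s * a ^ s" .
  have "n ^ s * a ^ s * 2 ^ (s * s) / c ^ (s - 1) = n * c"
  proof -
    have "n ^ s * a ^ s * 2 ^ (s * s) = n * (n ^ (s - 1) * a ^ s * 2 ^ (s * s))"
      using power_Suc[of n "s - 1"] s by simp
    also have "\<dots> = n * c ^ s" by (simp add: c_def power_mult_distrib b n_def power_mult)
    also have "\<dots> = n * c * c ^ (s - 1)" using power_Suc[of c "s - 1"] s by simp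
    finally show ?thesis using c by simp
  qed
  moreover have "(\<Sum>v\<in>V. ?X v) \<le> n ^ s * a ^ s * 2 ^ (s * s) / c ^ (s - 1)"
    unfolding sum_divide_distrib[symmetric] sum_distrib_right[symmetric]
    using count c by (intro divide_right_mono mult_right_mono) auto
  moreover have "(\<Sum>v\<in>V. d v) \<le> (\<Sum>v\<in>V. Q * b + c + ?X v)" by (intro sum_mono main)
  moreover have "(\<Sum>v\<in>V. Q * b + c + ?X v) = n * (Q * b + c) + (\<Sum>v\<in>V. ?X v)"
    by (simp add: sum.distrib n_def)
  ultimately have "(\<Sum>v\<in>V. d v) \<le> n * (Q * b + c) + n * c" by linarith
  also have "\<dots> = n * b * (Q + 2 * 2 ^ s * a)" by (simp add: c_def algebra_simps)
  finally show ?thesis by (simp add: d_def n_def Q_def)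
qed

end

section \<open>From vertex sets to copies of graphs\<close>

lemma clique_imp_contains_copy:
  assumes "simple_graph G" "K \<subseteq> verts G" "card K = r" "clique K (edges G)"
  shows "contains_copy G (complete_graph r)"
proof -
  have fin: "finite K" using assms finite_subset by (auto simp: simple_graph_def)
  obtain f where f: "bij_betw f {..<r} K"
    using ex_bij_betw_nat_finite[OF fin] assms(3) by (auto simp: atLeast0LessThan)
  have "nsets K 2 = (\<lambda>e. f ` e) ` nsets {..<r} 2"
    using bij_betw_nsets[OF f, of 2] by (simp add: bij_betw_def)
  then have "graph_iso (complete_graph r) (K, nsets K 2)"
    unfolding graph_iso_def complete_graph_def using f by auto
  moreover have "nsets K 2 \<subseteq> edges G"
    using assms(4) by (auto simp: clique_def elim!: nsets2_E)
  then have "subgraph (K, nsets K 2) G"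
    using fin assms by (auto simp: subgraph_def simple_graph_def)
  ultimately show ?thesis unfolding contains_copy_def by blast
qed

text \<open>The copy is induced because \<open>A\<close> and \<open>B\<close> are independent: every
  edge inside their union must cross. Absence of loops makes them disjoint, so the sum type embeds
  injectively.\<close>

lemma biclique_imp_contains_induced_copy:
  assumes G: "simple_graph G" and sub: "A \<subseteq> verts G" "B \<subseteq> verts G"
    and card: "card A = s" "card B = t"
    and ind: "indep A (edges G)" "indep B (edges G)" and full: "\<forall>a\<in>A. \<forall>b\<in>B. {a, b} \<in> edges G"
  shows "contains_induced_copy G (complete_bipartite_graph s t)"
proof -
  have loopless: "{x} \<notin> edges G" for x
    using G by (auto simp: simple_graph_def nsets_def)
  then have disj: "A \<inter> B = {}" using full by fastforce
  have fin: "finite A" "finite B" using G sub finite_subset by (auto simp: simple_graph_def)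
  obtain f g where f: "bij_betw f {..<s} A" and g: "bij_betw g {..<t} B"
    using ex_bij_betw_nat_finite fin card by (metis atLeast0LessThan)
  define h where "h = case_sum f g"
  define F where "F = {{a, b} | a b. a \<in> A \<and> b \<in> B}"
  have img: "A = f ` {..<s}" "B = g ` {..<t}" using f g by (auto simp: bij_betw_def)
  have ne: "f i \<noteq> g j" "g j \<noteq> f i" if "i < s" "j < t" for i j
    using disj that unfolding img by auto
  have h: "bij_betw h ({..<s} <+> {..<t}) (A \<union> B)"
    unfolding bij_betw_def
  proof
    show "inj_on h ({..<s} <+> {..<t})"
      using f g ne by (auto simp: h_def inj_on_def bij_betw_def)
    show "h ` ({..<s} <+> {..<t}) = A \<union> B"
      by (simp add: h_def img Plus_def image_Un image_image)
  qed
  have "{{Inl i, Inr j} | i j. i < s \<and> j < t} = (\<lambda>(i, j). {Inl i, Inr j}) ` ({..<s} \<times> {..<t})"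
    by auto
  then have "(\<lambda>e. h ` e) ` {{Inl i, Inr j} | i j. i < s \<and> j < t}
      = (\<lambda>(i, j). {f i, g j}) ` ({..<s} \<times> {..<t})"
    unfolding image_image by (simp add: h_def image_image split_beta)
  also have "\<dots> = F" unfolding F_def img by auto
  finally have iso: "graph_iso (complete_bipartite_graph s t) (A \<union> B, F)"
    unfolding graph_iso_def complete_bipartite_graph_def using h by auto
  have F: "F = {e \<in> edges G. e \<subseteq> A \<union> B}"
  proof
    show "{e \<in> edges G. e \<subseteq> A \<union> B} \<subseteq> F"
    proof
      fix e assume e: "e \<in> {e \<in> edges G. e \<subseteq> A \<union> B}"
      then obtain x y where xy: "e = {x, y}" "x \<noteq> y"
        using G by (auto simp: simple_graph_def elim!: nsets2_E)
      with e ind have "x \<in> A \<and> y \<in> B \<or> y \<in> A \<and> x \<in> B" by (auto simp: indep_def)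
      then show "e \<in> F" unfolding F_def xy by (auto simp: insert_commute)
    qed
  qed (use full in \<open>auto simp: F_def\<close>)
  have "F \<subseteq> nsets (A \<union> B) 2" using disj by (auto simp: F_def)
  then have "induced_subgraph (A \<union> B, F) G"
    unfolding induced_subgraph_def subgraph_def simple_graph_def using fin sub F by auto
  with iso show ?thesis unfolding contains_induced_copy_def by blast
qed

section \<open>The edge bound with real exponents\<close>

theorem theorem1:
  fixes r s t n :: nat and G :: "'a graph"
  assumes "r \<ge> 1" and "s \<ge> 1" and "t \<ge> 1"
    and "simple_graph G" and "card (verts G) = n"
    and "\<not> contains_copy G (complete_graph r)"
    and "\<not> contains_induced_copy G (complete_bipartite_graph s t)"
  shows "real (card (edges G)) \<le>
    real n powr (2 - 1 / real s) * 4 ^ s *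
      (real (r + t) powr (real t / real s) + real (r + s)
        + 2 * real (r + t) powr (real (t * (s + 1)) / real (s ^ 2)) * real (r + s))
    + 2 * 4 ^ s * real n"
proof (cases "n = 0")
  \<comment> \<open>The empty graph is treated apart: as \<open>0 powr 0 = 0\<close>, the identity
    \<open>b ^ s = n ^ (s - 1)\<close> below would fail for \<open>n = 0\<close> and
    \<open>s = 1\<close>.\<close>
  case True
  then have "edges G = {}" using assms(4,5) by (auto simp: simple_graph_def nsets_def)
  then show ?thesis using True by simp
next
  case False
  interpret clique_biclique_free "verts G" "edges G" r s t
  proof
    show "finite (verts G)" "\<And>x. {x} \<notin> edges G"
      using assms(4) by (auto simp: simple_graph_def nsets_def)
    show "\<not> clique K (edges G)" if "K \<subseteq> verts G" "card K = r" for K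
      using clique_imp_contains_copy[OF assms(4) that] assms(6) by auto
    show False if "A \<subseteq> verts G" "B \<subseteq> verts G" "card A = s" "card B = t"
      "indep A (edges G)" "indep B (edges G)" "\<forall>a\<in>A. \<forall>b\<in>B. {a, b} \<in> edges G" for A B
      using biclique_imp_contains_induced_copy[OF assms(4) that] assms(7) by simp
  qed (fact assms(2))
  define a where "a = real (r + t) powr (real t / real s)"
  define D where "D = real (r + t) powr (real (t * (s + 1)) / real (s ^ 2))"
  define b where "b = real n powr (1 - 1 / real s)"
  have pow: "(x powr y) ^ s = x powr (y * real s)" if "x > 0" for x y :: real
    using that by (simp add: powr_realpow[symmetric] powr_powr)
  have pos: "real (r + t) > 0" "real n > 0" using assms(1) False by auto
  have a1: "a \<ge> 1" unfolding a_def using assms(1) by (intro ge_one_powr_ge_zero) auto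
  have as: "a ^ s = real ((r + t) ^ t)"
  proof -
    have "a ^ s = real (r + t) powr real t" unfolding a_def pow[OF pos(1)] using assms(2) by simp
    then show ?thesis using pos by (simp add: powr_realpow)
  qed
  have Ds: "D ^ s = a ^ (s + 1)"
  proof -
    have "D ^ s = real (r + t) powr (real t / real s * real (s + 1))"
    proof -
      have "real (t * (s + 1)) / real (s ^ 2) * real s = real t / real s * real (s + 1)"
        using assms(2) unfolding of_nat_mult of_nat_power by (simp add: power2_eq_square)
      then show ?thesis unfolding D_def pow[OF pos(1)] by simp
    qed
    also have "\<dots> = a powr real (s + 1)" by (simp add: a_def powr_powr)
    also have "\<dots> = a ^ (s + 1)" using a1 by (intro powr_realpow) auto
    finally show ?thesis .
  qed
  have bs: "b ^ s = real (card (verts G)) ^ (s - 1)"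
  proof -
    have "(1 - 1 / real s) * real s = real (s - 1)"
      using assms(2) by (simp add: left_diff_distrib of_nat_diff)
    then have "b ^ s = real n powr real (s - 1)" unfolding b_def pow[OF pos(2)] by simp
    then show ?thesis using pos assms(5) by (simp add: powr_realpow)
  qed
  have nb: "real n powr (2 - 1 / real s) = real n * b"
    using pos by (simp add: b_def powr_mult_base)
  have "2 * real (card (edges G)) = real (\<Sum>v\<in>verts G. card (common_nbrs (edges G) (verts G) {v}))"
    using sum_card_nbrs[of "verts G" "edges G"] assms(4) by (simp add: simple_graph_def)
  also have "\<dots> \<le> real n * b * (4 * 4 ^ s * D * real (r + s) + 2 * 2 ^ s * a)"
  proof -
    have "verts G \<noteq> {}" "D \<ge> 0" "b \<ge> 0" using assms(5) False by (auto simp: D_def b_def)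
    then show ?thesis using sum_degree_le[OF a1 as _ Ds _ bs] assms(5) by simp
  qed
  also have "\<dots> \<le> real n * b * (4 * 4 ^ s * D * real (r + s) + 2 * 4 ^ s * a)"
    using a1 by (intro mult_left_mono add_left_mono mult_right_mono power_mono) (auto simp: b_def)
  finally have "real (card (edges G)) \<le> real n * b * 4 ^ s * (a + 2 * D * real (r + s))"
    by (simp add: algebra_simps)
  \<comment> \<open>The remaining summands of the claim are nonnegative and are simply
    added.\<close>
  also have "\<dots> \<le> real n * b * 4 ^ s * (a + real (r + s) + 2 * D * real (r + s))"
    by (intro mult_left_mono) (auto simp: b_def)
  also have "\<dots> \<le> real n * b * 4 ^ s * (a + real (r + s) + 2 * D * real (r + s)) + 2 * 4 ^ s * real n"
    by simp
  finally show ?thesis unfolding nb a_def D_def .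
qed

end
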